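(* Let $S=\langle m,n_2,\ldots,n_k\rangle$ be a numerical semigroup, suppose $T=\langle\alpha\rangle+\beta S$ is a monoscopic gluing, and let $F\subset\mathcal{C}(\mathbb{Z}_{\beta m})$ denote the face containing $T$. Any numerical semigroup $T'$ in $F$ can be expressed as a monoscopic gluing $T'=\langle\alpha'\rangle+\beta S'$, where $\alpha'\equiv\alpha\bmod\beta m$ and $S'$ is a numerical semigroup on the same face of $\mathcal{C}(\mathbb{Z}_m)$ as $S$.
   Context: A numerical semigroup is a subset $S \subseteq \mathbb{Z}_{\ge 0}$ containing $0$, closed under addition, with finite complement; $\langle n_1,\ldots,n_k\rangle$ denotes the set of all non-negative integer combinations of $n_1,\ldots,n_k$. For $m \in S$, $m>0$, the Apéry set $\operatorname{Ap}(S;m) = \{n \in S : n-m\notin S\}$ has exactly one element in each residue class modulo $m$; writing $\operatorname{Ap}(S;m) = \{0,a_1,\ldots,a_{m-1}\}$ with $a_i\equiv i \bmod m$, the Apéry tuple of $S$ (with respect to $m$) is $(a_1,\ldots,a_{m-1})$. For a positive integer $m$, the group cone $\mathcal{C}(\mathbb{Z}_m)\subset\mathbb{R}^{m-1}$ (coordinates indexed by $\mathbb{Z}_m\setminus\{0\}$) is the cone defined by the inequalities $x_i+x_j\ge x_{i+j}$ for $i,j\in\mathbb{Z}_m\setminus\{0\}$ with $i+j\ne 0$. A numerical semigroup $S$ with $m\in S$ is contained in (lies in, or on) a face $F$ of $\mathcal{C}(\mathbb{Z}_m)$ if the Apéry tuple of $S$ with respect to $m$ lies in the relative interior of $F$.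 Monoscopic gluing: given a numerical semigroup $S=\langle n_1,\ldots,n_k\rangle$, an integer $\beta\ge 2$, and an element $\alpha\in S\setminus\{n_1,\ldots,n_k\}$ with $\gcd(\alpha,\beta)=1$, the semigroup $T=\langle\alpha\rangle+\beta S=\langle\alpha,\beta n_1,\ldots,\beta n_k\rangle$ is called a monoscopic gluing of $S$.
   Formalization: As stated the claim fails: S=⟨2,3⟩, m=2, β=3, α=8, T'=⟨2,9⟩ forces α'=2, a generator of S'. The formal version allows α'=m, and only in that case drops the requirement that α' is not one of the generators of S'; all other conclusions are kept. *)

theory Defs
  imports "HOL-Analysis.Analysis" "HOL-Analysis.Finite_Function_Topology" "HOL-Library.Set_Algebras" "HOL-Number_Theory.Cong"
begin

definition numerical_semigroup :: "nat set \<Rightarrow> bool" where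
  "numerical_semigroup S \<longleftrightarrow>
     0 \<in> S \<and> (\<forall>a\<in>S. \<forall>b\<in>S. a + b \<in> S) \<and> finite (- S)"

(* Only meaningful for finite G: a sum over an infinite set is 0. *)
definition nat_span :: "nat set \<Rightarrow> nat set" where
  "nat_span G = {\<Sum>g\<in>G. c g * g | c :: nat \<Rightarrow> nat. True}"

(* The first disjunct is n - m < 0; subtraction on nat would truncate. *)
definition apery_set :: "nat set \<Rightarrow> nat \<Rightarrow> nat set" where
  "apery_set S m = {n \<in> S. n < m \<or> n - m \<notin> S}"

(* R^(m-1), with coordinates indexed by the nonzero residues modulo m, is the subspace of
   (nat \<Rightarrow>\<^sub>0 real) of the vectors supported on {1..<m}. The norm of nat \<Rightarrow>\<^sub>0 real is the l1-norm,
   so faces and relative interiors of subsets of this subspace are the usual ones. *)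

(* A choice of residue representatives: the coordinate i is the element of the Apery set
   congruent to i, unique for a numerical semigroup S with 0 < m and m \<in> S. *)
definition apery_tuple :: "nat set \<Rightarrow> nat \<Rightarrow> (nat \<Rightarrow>\<^sub>0 real)" where
  "apery_tuple S m = Abs_poly_mapping
     (\<lambda>i. if i \<in> {1..<m} then real (THE a. a \<in> apery_set S m \<and> a mod m = i) else 0)"

definition group_cone :: "nat \<Rightarrow> (nat \<Rightarrow>\<^sub>0 real) set" where
  "group_cone m = {x. Poly_Mapping.keys x \<subseteq> {1..<m} \<and>
     (\<forall>i\<in>{1..<m}. \<forall>j\<in>{1..<m}. (i + j) mod m \<noteq> 0 \<longrightarrow>
        Poly_Mapping.lookup x i + Poly_Mapping.lookup x j
          \<ge> Poly_Mapping.lookup x ((i + j) mod m))}"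

definition lies_on_face :: "nat set \<Rightarrow> nat \<Rightarrow> (nat \<Rightarrow>\<^sub>0 real) set \<Rightarrow> bool" where
  "lies_on_face S m F \<longleftrightarrow>
     numerical_semigroup S \<and> 0 < m \<and> m \<in> S \<and>
     F face_of group_cone m \<and> apery_tuple S m \<in> rel_interior F"

definition gluing :: "nat set \<Rightarrow> nat \<Rightarrow> nat \<Rightarrow> nat set" where
  "gluing S \<alpha> \<beta> = nat_span {\<alpha>} + (\<lambda>s. \<beta> * s) ` S"

(* T is the monoscopic gluing of the semigroup generated by the finite set G. The set G need
   not be the minimal generating set. *)
definition monoscopic_gluing :: "nat set \<Rightarrow> nat \<Rightarrow> nat \<Rightarrow> nat set \<Rightarrow> bool" where
  "monoscopic_gluing G \<alpha> \<beta> T \<longleftrightarrow>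
     finite G \<and> numerical_semigroup (nat_span G) \<and>
     2 \<le> \<beta> \<and> \<alpha> \<in> nat_span G - G \<and> coprime \<alpha> \<beta> \<and>
     T = gluing (nat_span G) \<alpha> \<beta>"

(* Pitfall: the condition that \<alpha> is not a generator need not persist along a face when m
   divides \<alpha>. For example <6,8,9> = <8> + 3<2,3> (here m = 2, \<alpha> = 8, \<beta> = 3) and
   <2,9> = <2> + 3<2,3> lie on the same face of the group cone for 6, with Apery sets
   {0,8,16,9,17,25} and {0,2,4,9,11,13}, but \<alpha>' = 2 is forced in the second gluing and 2 lies in
   every generating set of <2,3>. The only possible failure is \<alpha>' = m, so a statement
   about all semigroups on a face has to allow \<alpha>' = m. *)

end

theory Submission
  imports Defs
begin

text \<open>
  Two semigroups lie on a common face of the group cone iff the same inequalities are tight at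
  their Apery tuples. Let \<open>a\<close> be the Apery tuple of \<open>S\<close> modulo \<open>m\<close>. For \<open>T = \<langle>\<alpha>\<rangle> + \<beta>S\<close> the Apery
  element modulo \<open>\<beta>m\<close> in the class of \<open>\<beta>i + j\<alpha>\<close>, \<open>j < \<beta>\<close>, is \<open>\<beta>a\<^sub>i + j\<alpha>\<close>, so adding \<open>\<alpha>\<close> is tight as
  long as \<open>j + 1 < \<beta>\<close>. These equalities carry over to \<open>T'\<close>, with \<open>\<alpha>'\<close> the Apery element of \<open>T'\<close> in
  the class of \<open>\<alpha>\<close>, and say that \<open>T' = \<langle>\<alpha>'\<rangle> + \<beta>S'\<close> for \<open>S' = {s. \<beta>s \<in> T'}\<close>. The classes divisible
  by \<open>\<beta>\<close> show that \<open>S\<close> and \<open>S'\<close> have the same tight inequalities. Finally, if \<open>\<alpha>'\<close> is an Apery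
  element of \<open>S'\<close> not divisible by \<open>m\<close>, then so is \<open>\<alpha>\<close> for \<open>S\<close>, and a decomposition \<open>\<alpha> = p + q\<close> is a
  tight inequality that yields one of \<open>\<alpha>'\<close>.
\<close>

section \<open>Relative interiors of faces of polyhedral cones\<close>

text \<open>The segment from \<open>y\<close> to \<open>x\<close> can be prolonged a little beyond
  \<open>x\<close> inside \<open>F\<close>. At the new point \<open>f\<close> is a negative multiple
  of \<open>f y\<close>, yet it must be nonnegative.\<close>

lemma linear_zero_on_if_zero_at_rel_interior:
  fixes F :: "'a::real_normed_vector set" and f :: "'a \<Rightarrow> real"
  assumes f: "linear f" and nonneg: "\<And>z. z \<in> F \<Longrightarrow> 0 \<le> f z"
    and x: "x \<in> rel_interior F" and y: "y \<in> F" and "f x = 0"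
  shows "f y = 0"
proof -
  interpret f: linear f by (fact f)
  obtain U where U: "open U" "x \<in> U" "affine hull F \<inter> U \<subseteq> F" "x \<in> F"
    using x unfolding rel_interior_def openin_open by auto
  \<comment> \<open>For \<open>t > 0\<close> this point lies on the line through \<open>y\<close>
    and \<open>x\<close>, on the far side of \<open>x\<close>.\<close>
  define g where "g = (\<lambda>t::real. (1 + t) *\<^sub>R x + (- t) *\<^sub>R y)"
  have "open (g -` U)"
    unfolding g_def by (intro open_vimage U continuous_intros)
  moreover have "0 \<in> g -` U"
    using U by (simp add: g_def)
  ultimately obtain e where e: "0 < e" "ball 0 e \<subseteq> g -` U"
    using open_contains_ball by blast
  define t where "t = e / 2"
  have t: "0 < t" "g t \<in> U"
    using e by (auto simp: t_def subset_iff)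
  have "g t \<in> affine hull F"
    unfolding g_def by (intro mem_affine affine_affine_hull hull_inc U y) auto
  then have "0 \<le> f (g t)"
    using U t nonneg by blast
  also have "f (g t) = - t * f y"
    using \<open>f x = 0\<close> by (simp add: g_def f.add f.scaleR f.diff)
  finally show ?thesis
    using t nonneg[OF y] by (simp add: mult_le_0_iff)
qed

text \<open>If a combination of two nonnegative numbers with positive weights is zero, both are
  zero. So the equalities indexed by \<open>J\<close> pass from an inner point of a segment to its
  endpoints.\<close>

lemma polyhedral_cone_face:
  fixes f :: "'i \<Rightarrow> 'a::real_normed_vector \<Rightarrow> real"
  assumes f: "\<And>i. i \<in> I \<Longrightarrow> linear (f i)" and V: "subspace V" and J: "J \<subseteq> I"
  shows "{x \<in> V. (\<forall>i\<in>I. 0 \<le> f i x) \<and> (\<forall>i\<in>J. f i x = 0)} face_of {x \<in> V. \<forall>i\<in>I. 0 \<le> f i x}"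
    (is "?F face_of ?C")
  unfolding face_of_def
proof (intro conjI ballI impI)
  show "?F \<subseteq> ?C" by auto
  have comb: "f i (u *\<^sub>R a + v *\<^sub>R b) = u * f i a + v * f i b" if "i \<in> I" for i u v a b
    using f[OF that] by (simp add: linear_add linear_scale)
  show "convex ?F"
    unfolding convex_def using J
    by (auto simp: comb subset_iff intro!: subspace_add[OF V] subspace_mul[OF V])
  fix a b x
  assume ab: "a \<in> ?C" "b \<in> ?C" and x: "x \<in> ?F" "x \<in> open_segment a b"
  obtain u where u: "0 < u" "u < 1" "x = (1 - u) *\<^sub>R a + u *\<^sub>R b"
    using x(2) by (auto simp: in_segment)
  have "f i a = 0 \<and> f i b = 0" if i: "i \<in> J" for i
  proof -
    have "(1 - u) * f i a + u * f i b = 0"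
    proof -
      have "f i x = 0" "i \<in> I" using x(1) i J by auto
      then show ?thesis by (simp add: u(3) comb)
    qed
    moreover have "0 \<le> (1 - u) * f i a" "0 \<le> u * f i b"
      using ab u i J by (auto simp: subset_iff)
    ultimately have "(1 - u) * f i a = 0" "u * f i b = 0" by linarith+
    then show ?thesis using u by auto
  qed
  then show "a \<in> ?F" "b \<in> ?F" using ab by auto
qed

text \<open>The strict inequalities define an open set \<open>U\<close>, as \<open>I\<close> is
  finite, and the affine hull of the face satisfies the equalities. Hence the part of the hull in
  \<open>U\<close> is a relative neighbourhood of \<open>x\<close> inside the face.\<close>

lemma polyhedral_cone_face_rel_interior:
  fixes f :: "'i \<Rightarrow> 'a::real_normed_vector \<Rightarrow> real"
  assumes f: "\<And>i. i \<in> I \<Longrightarrow> bounded_linear (f i)" and V: "subspace V" and J: "J \<subseteq> I"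
    and I: "finite I" and x: "x \<in> V" "\<And>i. i \<in> J \<Longrightarrow> f i x = 0" "\<And>i. i \<in> I - J \<Longrightarrow> 0 < f i x"
  shows "x \<in> rel_interior {x \<in> V. (\<forall>i\<in>I. 0 \<le> f i x) \<and> (\<forall>i\<in>J. f i x = 0)}"
    (is "x \<in> rel_interior ?F")
proof -
  have comb: "f i (u *\<^sub>R a + v *\<^sub>R b) = u * f i a + v * f i b" if "i \<in> I" for i u v a b
    using bounded_linear.linear[OF f[OF that]] by (simp add: linear_add linear_scale)
  let ?A = "{x \<in> V. \<forall>i\<in>J. f i x = 0}"
  have "affine ?A"
    unfolding affine_def
  proof (intro ballI allI impI CollectI conjI)
    fix a b and u v :: real
    assume ab: "a \<in> ?A" "b \<in> ?A"
    then show "u *\<^sub>R a + v *\<^sub>R b \<in> V"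
      by (intro subspace_add[OF V] subspace_mul[OF V]) auto
    show "f i (u *\<^sub>R a + v *\<^sub>R b) = 0" if "i \<in> J" for i
    proof -
      have "i \<in> I" using that J by blast
      then show ?thesis using that ab by (simp add: comb)
    qed
  qed
  then have hull: "affine hull ?F \<subseteq> ?A"
    by (intro hull_minimal) auto
  define U where "U = (\<Inter>i\<in>I - J. {z. 0 < f i z})"
  have "open U"
    unfolding U_def using I f
    by (intro open_INT ballI open_Collect_less continuous_intros)
       (auto intro: linear_continuous_on)
  have "affine hull ?F \<inter> U \<subseteq> ?F"
  proof
    fix z assume z: "z \<in> affine hull ?F \<inter> U"
    then have "z \<in> ?A" using hull by blast
    moreover have "0 \<le> f i z" if "i \<in> I" for i
      using that z \<open>z \<in> ?A\<close> by (cases "i \<in> J") (auto simp: U_def less_imp_le)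
    ultimately show "z \<in> ?F" by auto
  qed
  moreover have "x \<in> U" using x by (auto simp: U_def)
  moreover have "0 \<le> f i x" if "i \<in> I" for i
    using that x by (cases "i \<in> J") (auto simp: less_imp_le)
  then have "x \<in> ?F" using x by auto
  moreover have "openin (top_of_set (affine hull ?F)) (affine hull ?F \<inter> U)"
    using \<open>open U\<close> by (rule openin_open_Int)
  ultimately show ?thesis
    unfolding rel_interior_def using hull_inc[of x ?F affine] by blast
qed

section \<open>Coordinates as bounded linear functionals\<close>

lemma norm_lookup_le: "norm (Poly_Mapping.lookup x i) \<le> norm x"
  for x :: "'a \<Rightarrow>\<^sub>0 'b::real_normed_vector"
proof (cases "i \<in> Poly_Mapping.keys x")
  case True
  then show ?thesis
    by (auto simp: norm_poly_mapping_def dist_poly_mapping_def intro: member_le_sum)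
qed (simp add: in_keys_iff)

lemma lookup_scaleR:
  "Poly_Mapping.lookup (r *\<^sub>R x) i = r *\<^sub>R Poly_Mapping.lookup x i"
  for x :: "'a \<Rightarrow>\<^sub>0 'b::real_vector"
proof -
  have "finite {i. r *\<^sub>R Poly_Mapping.lookup x i \<noteq> 0}"
    by (rule finite_subset[OF _ finite_keys[of x]]) (auto simp: in_keys_iff)
  then show ?thesis by (simp add: scaleR_poly_mapping_def)
qed

lemma bounded_linear_lookup:
  "bounded_linear (\<lambda>x::'a \<Rightarrow>\<^sub>0 'b::real_normed_vector. Poly_Mapping.lookup x i)"
  by (intro bounded_linear_intro[where K = 1])
     (auto simp: lookup_add lookup_scaleR norm_lookup_le)

section \<open>Apery tuples and the facial structure of the group cone\<close>

text \<open>The Apery element as the minimum of a residue class. The index \<open>k\<close> is any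
  natural number, so that sums of indices need no reduction modulo \<open>m\<close>.\<close>

definition apery :: "nat set \<Rightarrow> nat \<Rightarrow> nat \<Rightarrow> nat" where
  "apery S m k = (LEAST s. s \<in> S \<and> [s = k] (mod m))"

lemma numerical_semigroup_mult:
  assumes "numerical_semigroup S" "s \<in> S"
  shows "n * s \<in> S"
  using assms by (induction n) (auto simp: numerical_semigroup_def)

lemma apery_cong_arg: "[k = l] (mod m) \<Longrightarrow> apery S m k = apery S m l"
  unfolding apery_def by (metis cong_sym cong_trans)

lemma apery_eqI:
  assumes "s \<in> S" "[s = k] (mod m)" "\<And>t. t \<in> S \<Longrightarrow> [t = k] (mod m) \<Longrightarrow> s \<le> t"
  shows "apery S m k = s"
  unfolding apery_def using assms by (intro Least_equality) auto

locale semigroup_with_modulus =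
  fixes S :: "nat set" and m :: nat
  assumes semigroup: "numerical_semigroup S" and pos: "0 < m" and mem: "m \<in> S"
begin

lemma zero: "0 \<in> S" and add: "a \<in> S \<Longrightarrow> b \<in> S \<Longrightarrow> a + b \<in> S"
  using semigroup by (auto simp: numerical_semigroup_def)

text \<open>A residue class is infinite, whereas \<open>S\<close> misses only finitely many
  numbers.\<close>

lemma ex_cong: "\<exists>s. s \<in> S \<and> [s = k] (mod m)"
proof -
  have "inj (\<lambda>n. k + n * m)" using pos by (auto simp: inj_def)
  then have "infinite (range (\<lambda>n. k + n * m))" by (rule range_inj_infinite)
  moreover have "finite (- S)" using semigroup by (simp add: numerical_semigroup_def)
  ultimately have "\<not> range (\<lambda>n. k + n * m) \<subseteq> - S" using finite_subset by blast
  then obtain n where "k + n * m \<in> S" by auto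
  moreover have "[k + n * m = k] (mod m)" by (simp add: cong_def)
  ultimately show ?thesis by blast
qed

lemma apery_mem: "apery S m k \<in> S" and apery_cong: "[apery S m k = k] (mod m)"
  using LeastI_ex[OF ex_cong] unfolding apery_def by auto

lemma apery_le: "s \<in> S \<Longrightarrow> [s = k] (mod m) \<Longrightarrow> apery S m k \<le> s"
  unfolding apery_def by (simp add: Least_le)

lemma apery_0 [simp]: "apery S m 0 = 0"
  using apery_le[OF zero] by simp

lemma eq_apery_plus: obtains n where "s \<in> S \<Longrightarrow> s = apery S m s + n * m"
proof (cases "s \<in> S")
  case True
  then have "apery S m s \<le> s" by (intro apery_le) auto
  moreover have "[s = apery S m s] (mod m)" using apery_cong cong_sym by blast
  ultimately show ?thesis using that cong_le_nat by (metis add.commute)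
qed (use that in blast)

lemma apery_add_le: "apery S m (i + j) \<le> apery S m i + apery S m j"
  by (intro apery_le add apery_mem cong_add apery_cong)

text \<open>Links the definition through \<open>a - m\<close> to minimality: an element of
  \<open>S\<close> exceeds the minimum of its class by a multiple of \<open>m\<close>, and if this
  multiple is positive, subtracting \<open>m\<close> stays in \<open>S\<close>.\<close>

lemma mem_apery_set_iff: "a \<in> apery_set S m \<longleftrightarrow> a = apery S m a"
proof
  assume a: "a \<in> apery_set S m"
  then have "a \<in> S" by (simp add: apery_set_def)
  obtain n where n: "a = apery S m a + n * m" using eq_apery_plus \<open>a \<in> S\<close> by blast
  have "n = 0"
  proof (rule ccontr)
    assume "n \<noteq> 0"
    then obtain k where k: "n = Suc k" using not0_implies_Suc by blast
    have "a - m = apery S m a + k * m" using n k by simp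
    then have "a - m \<in> S"
      using add[OF apery_mem numerical_semigroup_mult[OF semigroup mem]] by simp
    moreover have "m \<le> a" using n k by simp
    ultimately show False using a by (auto simp: apery_set_def)
  qed
  then show "a = apery S m a" using n by simp
next
  assume a: "a = apery S m a"
  have "a - m \<notin> S" if "m \<le> a"
  proof
    assume "a - m \<in> S"
    moreover have "[a - m = a] (mod m)" using that by (simp add: cong_def le_mod_geq)
    ultimately have "a \<le> a - m" using a apery_le by metis
    then show False using that pos by simp
  qed
  moreover have "a \<in> S" using a apery_mem by metis
  ultimately show "a \<in> apery_set S m"
    by (auto simp: apery_set_def not_less)
qed

lemma lookup_apery_tuple:
  "Poly_Mapping.lookup (apery_tuple S m) i = (if i \<in> {1..<m} then real (apery S m i) else 0)"
proof -
  have "(THE a. a \<in> apery_set S m \<and> a mod m = i) = apery S m i" if "i \<in> {1..<m}" for i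
  proof (rule the_equality)
    have "apery S m (apery S m i) = apery S m i" by (rule apery_cong_arg[OF apery_cong])
    then show "apery S m i \<in> apery_set S m \<and> apery S m i mod m = i"
      using that apery_cong[of i] by (simp add: mem_apery_set_iff cong_def)
  next
    fix a assume "a \<in> apery_set S m \<and> a mod m = i"
    then show "a = apery S m i"
      using apery_cong_arg[of a i m S] that by (auto simp: mem_apery_set_iff cong_def)
  qed
  then have "apery_tuple S m =
      Abs_poly_mapping (\<lambda>i. if i \<in> {1..<m} then real (apery S m i) else 0)"
    unfolding apery_tuple_def by (intro arg_cong[where f = Abs_poly_mapping]) auto
  moreover have "finite {i. (if i \<in> {1..<m} then real (apery S m i) else 0) \<noteq> 0}"
    by (rule finite_subset[of _ "{1..<m}"]) (auto split: if_splits)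
  ultimately show ?thesis by simp
qed

text \<open>Residue 0 is included: the default value 0 of the tuple there agrees with the Apery
  element 0.\<close>

lemma apery_eq_lookup:
  "real (apery S m k) = Poly_Mapping.lookup (apery_tuple S m) (k mod m)"
proof (cases "k mod m = 0")
  case True
  then have "apery S m k = apery S m 0" by (intro apery_cong_arg) (simp add: cong_def)
  then show ?thesis by (simp add: lookup_apery_tuple True)
next
  case False
  have "apery S m k = apery S m (k mod m)" by (intro apery_cong_arg) simp
  then show ?thesis using False pos by (simp add: lookup_apery_tuple)
qed

end

section \<open>Slack functionals and faces of the group cone\<close>

definition cone_index :: "nat \<Rightarrow> (nat \<times> nat) set" where
  "cone_index m = {(i, j). i \<in> {1..<m} \<and> j \<in> {1..<m} \<and> (i + j) mod m \<noteq> 0}"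

definition cone_slack :: "nat \<Rightarrow> nat \<times> nat \<Rightarrow> (nat \<Rightarrow>\<^sub>0 real) \<Rightarrow> real" where
  "cone_slack m = (\<lambda>(i, j) x. Poly_Mapping.lookup x i + Poly_Mapping.lookup x j
     - Poly_Mapping.lookup x ((i + j) mod m))"

lemma finite_cone_index: "finite (cone_index m)"
  by (rule finite_subset[of _ "{1..<m} \<times> {1..<m}"]) (auto simp: cone_index_def)

lemma bounded_linear_cone_slack: "bounded_linear (cone_slack m p)"
  unfolding cone_slack_def case_prod_unfold
  by (intro bounded_linear_add bounded_linear_sub bounded_linear_lookup)

lemma subspace_keys: "subspace {x :: 'a \<Rightarrow>\<^sub>0 real. Poly_Mapping.keys x \<subseteq> A}"
  unfolding subspace_def
  by (auto simp: lookup_add lookup_scaleR in_keys_iff subset_iff)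
     (metis add.right_neutral)

lemma group_cone_eq:
  "group_cone m =
     {x \<in> {x. Poly_Mapping.keys x \<subseteq> {1..<m}}. \<forall>p\<in>cone_index m. 0 \<le> cone_slack m p x}"
  unfolding group_cone_def cone_index_def cone_slack_def by auto

lemma lies_on_face_semigroup: "lies_on_face S m F \<Longrightarrow> semigroup_with_modulus S m"
  by (simp add: lies_on_face_def semigroup_with_modulus_def)

context semigroup_with_modulus
begin

lemma cone_slack_apery_tuple:
  "cone_slack m (i mod m, j mod m) (apery_tuple S m) =
     real (apery S m i) + real (apery S m j) - real (apery S m (i + j))"
  by (simp add: cone_slack_def apery_eq_lookup mod_add_eq)

lemma tight_iff_slack:
  "apery S m i + apery S m j = apery S m (i + j) \<longleftrightarrow>
     cone_slack m (i mod m, j mod m) (apery_tuple S m) = 0"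
  unfolding cone_slack_apery_tuple by linarith

lemma keys_apery_tuple: "Poly_Mapping.keys (apery_tuple S m) \<subseteq> {1..<m}"
  by (auto simp: in_keys_iff lookup_apery_tuple split: if_splits)

text \<open>Pairs with a zero residue index no inequality of the cone. Their equality is automatic,
  which allows tightness to be discussed for arbitrary natural indices.\<close>

lemma tight_if_dvd:
  assumes "m dvd i \<or> m dvd j"
  shows "apery S m i + apery S m j = apery S m (i + j)"
  using assms
proof
  assume "m dvd i"
  then have "[i = 0] (mod m)" "[i + j = j] (mod m)"
    by (auto simp: cong_0_iff cong_add_rcancel_0_nat)
  then show ?thesis using apery_cong_arg apery_0 by (metis add_0)
next
  assume "m dvd j"
  then have "[j = 0] (mod m)" "[i + j = i] (mod m)"
    by (auto simp: cong_0_iff cong_add_lcancel_0_nat)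
  then show ?thesis using apery_cong_arg apery_0 by (metis add_0_right)
qed

end

text \<open>A slack is nonnegative on \<open>F\<close>. If it vanishes at the tuple of
  \<open>S\<close>, a relative interior point, it vanishes on all of \<open>F\<close>, in particular
  at the tuple of \<open>T\<close>.\<close>

lemma same_face_tight_imp:
  assumes S: "lies_on_face S m F" and T: "lies_on_face T m F" and ij: "\<not> m dvd i + j"
    and tight: "apery S m i + apery S m j = apery S m (i + j)"
  shows "apery T m i + apery T m j = apery T m (i + j)"
proof -
  interpret S: semigroup_with_modulus S m by (rule lies_on_face_semigroup[OF S])
  interpret T: semigroup_with_modulus T m by (rule lies_on_face_semigroup[OF T])
  show ?thesis
  proof (cases "m dvd i \<or> m dvd j")
    case False
    define p where "p = (i mod m, j mod m)"
    have p: "p \<in> cone_index m"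
      using False ij S.pos
      by (auto simp: p_def cone_index_def mod_add_eq dvd_eq_mod_eq_0 Suc_le_eq)
    have F: "F \<subseteq> group_cone m"
      using S by (auto simp: lies_on_face_def face_of_def)
    have "cone_slack m p (apery_tuple T m) = 0"
    proof (rule linear_zero_on_if_zero_at_rel_interior[where f = "cone_slack m p"])
      show "linear (cone_slack m p)"
        by (rule bounded_linear.linear[OF bounded_linear_cone_slack])
      show "0 \<le> cone_slack m p z" if "z \<in> F" for z
        using F that p by (auto simp: group_cone_eq)
      show "apery_tuple S m \<in> rel_interior F" using S by (simp add: lies_on_face_def)
      show "apery_tuple T m \<in> F"
        using T rel_interior_subset by (auto simp: lies_on_face_def)
      show "cone_slack m p (apery_tuple S m) = 0" using tight by (simp add: S.tight_iff_slack p_def)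
    qed
    then show ?thesis by (simp add: T.tight_iff_slack p_def)
  qed (rule T.tight_if_dvd)
qed

lemma same_face_tight_iff:
  assumes "lies_on_face S m F" "lies_on_face T m F" "\<not> m dvd i + j"
  shows "apery S m i + apery S m j = apery S m (i + j) \<longleftrightarrow>
         apery T m i + apery T m j = apery T m (i + j)"
  using assms same_face_tight_imp by blast

text \<open>The converse direction: setting to zero the slacks that vanish for \<open>S\<close> cuts
  out a face. All other slacks are positive at both tuples, so both lie in its relative
  interior.\<close>

lemma ex_common_face:
  assumes S: "semigroup_with_modulus S m" and T: "semigroup_with_modulus T m"
    and tight: "\<And>i j. \<not> m dvd i + j \<Longrightarrow>
      apery S m i + apery S m j = apery S m (i + j) \<longleftrightarrow>
      apery T m i + apery T m j = apery T m (i + j)"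
  shows "\<exists>F. lies_on_face S m F \<and> lies_on_face T m F"
proof -
  interpret S: semigroup_with_modulus S m by (fact S)
  interpret T: semigroup_with_modulus T m by (fact T)
  define V where "V = {x :: nat \<Rightarrow>\<^sub>0 real. Poly_Mapping.keys x \<subseteq> {1..<m}}"
  define J where "J = {p \<in> cone_index m. cone_slack m p (apery_tuple S m) = 0}"
  define F where
    "F = {x \<in> V. (\<forall>p\<in>cone_index m. 0 \<le> cone_slack m p x) \<and> (\<forall>p\<in>J. cone_slack m p x = 0)}"
  have V: "subspace V" unfolding V_def by (rule subspace_keys)
  have J: "J \<subseteq> cone_index m" by (auto simp: J_def)
  have face: "F face_of group_cone m"
    unfolding group_cone_eq F_def V_def[symmetric]
    by (intro polyhedral_cone_face V J bounded_linear.linear bounded_linear_cone_slack)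
  have slack: "0 \<le> cone_slack m p (apery_tuple R m)"
    if R: "semigroup_with_modulus R m" and p: "p \<in> cone_index m" for R p
  proof -
    interpret R: semigroup_with_modulus R m by (fact R)
    \<comment> \<open>The entries of \<open>p\<close> are below \<open>m\<close>, hence equal to
      their own residues.\<close>
    obtain i j where ij: "p = (i mod m, j mod m)"
      using p that by (auto simp: cone_index_def) (metis mod_less)
    have "apery R m (i + j) \<le> apery R m i + apery R m j"
      by (rule R.apery_add_le)
    then show ?thesis unfolding ij R.cone_slack_apery_tuple by linarith
  qed
  have J_iff: "p \<in> J \<longleftrightarrow> cone_slack m p (apery_tuple R m) = 0"
    if R: "R = S \<or> R = T" and p: "p \<in> cone_index m" for R p
  proof -
    obtain i j where ij: "p = (i mod m, j mod m)" "\<not> m dvd i + j"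
      using p that by (auto simp: cone_index_def dvd_eq_mod_eq_0) (metis mod_less)
    show ?thesis
      using R p tight[OF ij(2)] unfolding J_def ij S.tight_iff_slack T.tight_iff_slack by auto
  qed
  have "apery_tuple R m \<in> rel_interior F" if R: "R = S \<or> R = T" for R
    unfolding F_def
  proof (rule polyhedral_cone_face_rel_interior)
    show "apery_tuple R m \<in> V"
      using R S.keys_apery_tuple T.keys_apery_tuple by (auto simp: V_def)
    show "cone_slack m p (apery_tuple R m) = 0" if "p \<in> J" for p
      using J_iff[OF R] that J by blast
    show "0 < cone_slack m p (apery_tuple R m)" if "p \<in> cone_index m - J" for p
    proof -
      have "cone_slack m p (apery_tuple R m) \<noteq> 0" using J_iff[OF R] that by blast
      moreover have "0 \<le> cone_slack m p (apery_tuple R m)" using slack R S T that by blast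
      ultimately show ?thesis by linarith
    qed
  qed (use V J finite_cone_index bounded_linear_cone_slack in auto)
  then show ?thesis
    using face S.semigroup S.pos S.mem T.semigroup T.mem by (auto simp: lies_on_face_def)
qed

section \<open>Generating sets and gluings\<close>

lemma nat_span_base:
  assumes "finite G" "g \<in> G"
  shows "g \<in> nat_span G"
proof -
  have "g = (\<Sum>h\<in>G. (if h = g then 1 else 0) * h)"
    using assms by (simp add: if_distrib[of "\<lambda>x. x * _"] sum.delta' cong: if_cong)
  then show ?thesis
    unfolding nat_span_def by (intro CollectI exI[of _ "\<lambda>h. if h = g then 1 else 0"] conjI TrueI)
qed

lemma nat_span_add:
  assumes "a \<in> nat_span G" "b \<in> nat_span G"
  shows "a + b \<in> nat_span G"
proof -
  obtain c d where "a = (\<Sum>g\<in>G. c g * g)" "b = (\<Sum>g\<in>G. d g * g)"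
    using assms by (auto simp: nat_span_def)
  then have "a + b = (\<Sum>g\<in>G. (c g + d g) * g)"
    by (simp add: sum.distrib distrib_right)
  then show ?thesis
    unfolding nat_span_def by (intro CollectI exI[of _ "\<lambda>g. c g + d g"] conjI TrueI)
qed

lemma nat_span_mult:
  assumes "a \<in> nat_span G"
  shows "n * a \<in> nat_span G"
proof -
  obtain c where "a = (\<Sum>g\<in>G. c g * g)"
    using assms by (auto simp: nat_span_def)
  then have "n * a = (\<Sum>g\<in>G. (n * c g) * g)"
    by (simp add: sum_distrib_left mult.assoc)
  then show ?thesis
    unfolding nat_span_def by (intro CollectI exI[of _ "\<lambda>g. n * c g"] conjI TrueI)
qed

lemma nat_span_subset:
  assumes S: "numerical_semigroup S" and G: "G \<subseteq> S"
  shows "nat_span G \<subseteq> S"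
proof -
  have "(\<Sum>g\<in>H. c g * g) \<in> S" if "H \<subseteq> S" for H c
    using that
  proof (induction H rule: infinite_finite_induct)
    case (insert h H)
    then have "c h * h \<in> S" "(\<Sum>g\<in>H. c g * g) \<in> S"
      using numerical_semigroup_mult[OF S] by auto
    then show ?case
      using insert.hyps S by (simp add: numerical_semigroup_def)
  qed (use S in \<open>auto simp: numerical_semigroup_def\<close>)
  then show ?thesis using G by (auto simp: nat_span_def)
qed

text \<open>One copy of a generator that occurs in \<open>a\<close> is split off; the rest is
  nonzero because \<open>a\<close> is not itself a generator.\<close>

lemma nat_span_decompose:
  assumes G: "finite G" and a: "a \<in> nat_span G" "a \<notin> G" "a \<noteq> 0"
  obtains p q where "p \<in> nat_span G" "q \<in> nat_span G" "p \<noteq> 0" "q \<noteq> 0" "a = p + q"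
proof -
  obtain c where c: "a = (\<Sum>g\<in>G. c g * g)" using a by (auto simp: nat_span_def)
  then obtain g where g: "g \<in> G" "c g * g \<noteq> 0"
    using a(3) sum.neutral by (metis (no_types, lifting))
  \<comment> \<open>The subtraction does not truncate, since \<open>c g\<close> is nonzero.\<close>
  define q where "q = (\<Sum>h\<in>G. (c(g := c g - 1)) h * h)"
  have "a = c g * g + (\<Sum>h\<in>G - {g}. c h * h)"
    unfolding c by (rule sum.remove[OF G g(1)])
  also have "(\<Sum>h\<in>G - {g}. c h * h) = (\<Sum>h\<in>G - {g}. (c(g := c g - 1)) h * h)"
    by (rule sum.cong) auto
  also have "c g * g = g + (c g - 1) * g"
    using g(2) by (cases "c g") auto
  finally have "a = g + q"
    unfolding q_def by (subst sum.remove[OF G g(1)]) simp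
  moreover have "q \<in> nat_span G" by (auto simp: nat_span_def q_def)
  ultimately show thesis
    using that[of g q] g a(2) nat_span_base[OF G g(1)] by (cases "q = 0") auto
qed

lemma (in semigroup_with_modulus) ex_generators_avoiding_sum:
  assumes "p \<in> S" "q \<in> S" "p \<noteq> 0" "q \<noteq> 0"
  shows "\<exists>G. finite G \<and> S = nat_span G \<and> p + q \<notin> G"
proof -
  define H where "H = insert m (insert p (insert q (apery S m ` {..<m})))"
  define G where "G = H - {p + q}"
  have G: "finite G" "G \<subseteq> S"
    using assms mem apery_mem by (auto simp: G_def H_def)
  have "p \<in> G" "q \<in> G"
    using assms by (auto simp: G_def H_def)
  then have "p \<in> nat_span G" "q \<in> nat_span G"
    by (auto intro: nat_span_base[OF G(1)])
  then have H: "H \<subseteq> nat_span G"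
    using nat_span_base[OF G(1)] nat_span_add[of p G q] by (auto simp: G_def)
  have "s \<in> nat_span G" if s: "s \<in> S" for s
  proof -
    obtain n where n: "s = apery S m s + n * m" using eq_apery_plus s by blast
    have "apery S m s = apery S m (s mod m)" by (intro apery_cong_arg) simp
    then have "apery S m s \<in> H" using pos by (auto simp: H_def)
    moreover have "m \<in> H" by (simp add: H_def)
    ultimately show ?thesis
      using H nat_span_add nat_span_mult by (subst n) blast
  qed
  then have "S = nat_span G" using nat_span_subset[OF semigroup G(2)] by blast
  then show ?thesis using G(1) by (intro exI[of _ G]) (simp add: G_def)
qed

section \<open>Apery elements of gluings\<close>

lemma mem_gluing_iff: "t \<in> gluing S \<alpha> \<beta> \<longleftrightarrow> (\<exists>c. \<exists>s\<in>S. t = c * \<alpha> + \<beta> * s)"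
  by (auto simp: gluing_def nat_span_def set_plus_def)

lemma cong_mult_same_iff:
  "0 < k \<Longrightarrow> [k * a = k * b] (mod k * n) \<longleftrightarrow> [a = b] (mod n)"
  for a b k n :: nat
  by (simp add: cong_def flip: mult_mod_right)

text \<open>Inverting \<alpha> modulo \<beta> gives \<open>j\<close>; then \<open>k\<close> minus
  \<open>j * \<alpha>\<close> is divisible by \<beta>, which gives \<open>i\<close>.\<close>

lemma ex_residue_representation:
  fixes \<alpha> \<beta> m k :: nat
  assumes "coprime \<alpha> \<beta>" "0 < \<beta>" "0 < m"
  obtains i j where "j < \<beta>" "[\<beta> * i + j * \<alpha> = k] (mod \<beta> * m)"
proof -
  obtain x where x: "[\<alpha> * x = 1] (mod \<beta>)"
    using cong_solve_coprime_nat[OF assms(1)] by auto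
  define j where "j = (x * k) mod \<beta>"
  have "[j * \<alpha> = x * k * \<alpha>] (mod \<beta>)"
    unfolding j_def by (intro cong_mult) auto
  also have "x * k * \<alpha> = \<alpha> * x * k" by simp
  also have "[\<alpha> * x * k = 1 * k] (mod \<beta>)" by (intro cong_mult x) simp
  \<comment> \<open>A multiple of the modulus is added to \<open>k\<close> so that
    \<open>j * \<alpha>\<close> can be subtracted within the naturals.\<close>
  finally have "[k + \<beta> * (m * (j * \<alpha>)) = j * \<alpha>] (mod \<beta>)"
    by (simp add: cong_def)
  moreover have "1 * (j * \<alpha>) \<le> (\<beta> * m) * (j * \<alpha>)"
    using assms by (intro mult_right_mono) (auto simp: Suc_le_eq)
  then have "j * \<alpha> \<le> k + \<beta> * (m * (j * \<alpha>))" by (metis add.commute mult.assoc mult_1 trans_le_add1)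
  ultimately obtain i where i: "k + \<beta> * (m * (j * \<alpha>)) = i * \<beta> + j * \<alpha>"
    using cong_le_nat by blast
  have "[k + \<beta> * m * (j * \<alpha>) = k] (mod \<beta> * m)" by (simp add: cong_def)
  then have "[\<beta> * i + j * \<alpha> = k] (mod \<beta> * m)"
    using i by (simp add: mult.commute mult.left_commute)
  moreover have "j < \<beta>" using assms by (simp add: j_def)
  ultimately show thesis using that by blast
qed

text \<open>Any element of the class uses \<alpha> a number of times congruent to \<open>j\<close>
  modulo \<beta>. Since \<alpha> is in \<open>S\<close>, the surplus multiples of \<beta> move into
  the summand from \<open>S\<close>, where minimality modulo \<open>m\<close> applies.\<close>

lemma apery_gluing:
  assumes S: "semigroup_with_modulus S m" and "\<alpha> \<in> S" "coprime \<alpha> \<beta>" and j: "j < \<beta>"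
  shows "apery (gluing S \<alpha> \<beta>) (\<beta> * m) (\<beta> * i + j * \<alpha>) = \<beta> * apery S m i + j * \<alpha>"
proof (rule apery_eqI)
  interpret semigroup_with_modulus S m by (fact S)
  show "\<beta> * apery S m i + j * \<alpha> \<in> gluing S \<alpha> \<beta>"
    using apery_mem by (auto simp: mem_gluing_iff add.commute)
  show "[\<beta> * apery S m i + j * \<alpha> = \<beta> * i + j * \<alpha>] (mod \<beta> * m)"
    using j by (simp add: cong_add_rcancel_nat cong_mult_same_iff apery_cong)
  fix t assume t: "t \<in> gluing S \<alpha> \<beta>" "[t = \<beta> * i + j * \<alpha>] (mod \<beta> * m)"
  then obtain c s where cs: "s \<in> S" "t = c * \<alpha> + \<beta> * s"
    by (auto simp: mem_gluing_iff)
  have "[t = \<beta> * i + j * \<alpha>] (mod \<beta>)"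
    using t(2) by (rule cong_dvd_modulus_nat) simp
  then have "[c * \<alpha> = j * \<alpha>] (mod \<beta>)"
    by (simp add: cs(2) cong_def)
  then have "[c = j] (mod \<beta>)"
    using assms by (simp add: cong_mult_rcancel_nat)
  then have "c mod \<beta> = j" using j by (simp add: cong_def)
  then have c: "c = j + \<beta> * (c div \<beta>)"
    by (metis add.commute mult_div_mod_eq)
  define x where "x = c div \<beta> * \<alpha> + s"
  have tx: "t = \<beta> * x + j * \<alpha>"
    unfolding cs(2) x_def by (subst c) (simp add: algebra_simps)
  have "[x = i] (mod m)"
    using t(2) j by (simp add: tx cong_add_rcancel_nat cong_mult_same_iff)
  moreover have "x \<in> S"
    unfolding x_def by (intro add numerical_semigroup_mult[OF semigroup] assms cs)
  ultimately have "apery S m i \<le> x" by (intro apery_le)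
  then show "\<beta> * apery S m i + j * \<alpha> \<le> t" by (simp add: tx)
qed

section \<open>Semigroups on the face of a gluing\<close>

locale gluing_face = semigroup_with_modulus S m for S m +
  fixes \<alpha> \<beta> :: nat and T' :: "nat set" and F :: "(nat \<Rightarrow>\<^sub>0 real) set"
  assumes alpha: "\<alpha> \<in> S" "coprime \<alpha> \<beta>" and beta: "2 \<le> \<beta>"
    and face: "lies_on_face (gluing S \<alpha> \<beta>) (\<beta> * m) F" "lies_on_face T' (\<beta> * m) F"
begin

sublocale T': semigroup_with_modulus T' "\<beta> * m"
  by (rule lies_on_face_semigroup[OF face(2)])

text \<open>Modelled on the original gluing, where \<alpha> is the Apery element of its own
  class.\<close>

definition alpha' :: nat where "alpha' = apery T' (\<beta> * m) \<alpha>"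

text \<open>The quotient of the semigroup \<open>T'\<close> by \<beta>.\<close>

definition S' :: "nat set" where "S' = {s. \<beta> * s \<in> T'}"

lemmas apery_T = apery_gluing[OF semigroup_with_modulus_axioms alpha]

lemma tight_T_iff:
  assumes "\<not> \<beta> * m dvd i + j"
  shows "apery (gluing S \<alpha> \<beta>) (\<beta> * m) i + apery (gluing S \<alpha> \<beta>) (\<beta> * m) j
      = apery (gluing S \<alpha> \<beta>) (\<beta> * m) (i + j) \<longleftrightarrow>
    apery T' (\<beta> * m) i + apery T' (\<beta> * m) j = apery T' (\<beta> * m) (i + j)"
  by (rule same_face_tight_iff[OF face assms])

lemma apery_T_alpha: "apery (gluing S \<alpha> \<beta>) (\<beta> * m) \<alpha> = \<alpha>"
  using apery_T[of 1 0] beta by simp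

lemma alpha'_cong: "[alpha' = \<alpha>] (mod \<beta> * m)"
  unfolding alpha'_def by (rule T'.apery_cong)

lemma alpha'_mem_T': "alpha' \<in> T'"
  unfolding alpha'_def by (rule T'.apery_mem)

lemma coprime_alpha': "coprime alpha' \<beta>"
proof -
  have "[alpha' = \<alpha>] (mod \<beta>)" using alpha'_cong by (rule cong_dvd_modulus_nat) simp
  then show ?thesis using alpha cong_imp_coprime cong_sym by blast
qed

text \<open>Induction along the chain of equalities for adding \<alpha>: each is tight in the
  original gluing and therefore in \<open>T'\<close>.\<close>

lemma apery_T':
  assumes "j < \<beta>"
  shows "apery T' (\<beta> * m) (\<beta> * i + j * \<alpha>) = apery T' (\<beta> * m) (\<beta> * i) + j * alpha'"
  using assms
proof (induction j)
  case (Suc j)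
  \<comment> \<open>By coprimality and \<open>Suc j < \<beta>\<close>. The target class is thus
    nonzero, as the comparison of tight inequalities requires.\<close>
  have "\<not> \<beta> dvd Suc j * \<alpha>"
    using Suc.prems alpha(2) by (metis coprime_commute coprime_dvd_mult_left_iff nat_dvd_not_less zero_less_Suc)
  then have "\<not> \<beta> dvd (\<beta> * i + j * \<alpha>) + \<alpha>"
    by (metis add.assoc add.commute dvd_add_right_iff dvd_triv_left mult_Suc)
  then have "\<not> \<beta> * m dvd (\<beta> * i + j * \<alpha>) + \<alpha>"
    using dvd_mult_left by blast
  note tight_T_iff[OF this]
  moreover have "(\<beta> * i + j * \<alpha>) + \<alpha> = \<beta> * i + Suc j * \<alpha>" by simp
  ultimately show ?case
    using Suc apery_T[of j i] apery_T[of "Suc j" i]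
    by (simp only: apery_T_alpha flip: alpha'_def) simp
qed simp

sublocale S': semigroup_with_modulus S' m
proof
  \<comment> \<open>Multiplication by \<beta> embeds the gaps of \<open>S'\<close> into the finitely
    many gaps of \<open>T'\<close>.\<close>
  have "inj_on ((*) \<beta>) (- S')" using beta by (auto simp: inj_on_def)
  moreover have "(*) \<beta> ` (- S') \<subseteq> - T'" by (auto simp: S'_def)
  moreover have "finite (- T')" using T'.semigroup by (simp add: numerical_semigroup_def)
  ultimately have "finite (- S')" by (meson finite_imageD finite_subset)
  then show "numerical_semigroup S'"
    using T'.zero T'.add by (auto simp: numerical_semigroup_def S'_def distrib_left)
  show "0 < m" by (rule pos)
  show "m \<in> S'" using T'.mem by (simp add: S'_def)
qed

text \<open>All members of the class of \<open>\<beta> * i\<close> modulo \<open>\<beta> * m\<close>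
  are multiples of \<beta>; dividing by \<beta> turns those in \<open>T'\<close> into the members of
  \<open>S'\<close> in the class of \<open>i\<close>.\<close>

lemma apery_S': "\<beta> * apery S' m i = apery T' (\<beta> * m) (\<beta> * i)"
proof -
  have c: "[apery T' (\<beta> * m) (\<beta> * i) = \<beta> * i] (mod \<beta> * m)" by (rule T'.apery_cong)
  then have "[apery T' (\<beta> * m) (\<beta> * i) = \<beta> * i] (mod \<beta>)"
    by (rule cong_dvd_modulus_nat) simp
  then have "\<beta> dvd apery T' (\<beta> * m) (\<beta> * i)"
    by (simp add: cong_def dvd_eq_mod_eq_0)
  then obtain s where s: "apery T' (\<beta> * m) (\<beta> * i) = \<beta> * s" by blast
  have "apery S' m i = s"
  proof (rule apery_eqI)
    show "s \<in> S'" using T'.apery_mem[of "\<beta> * i"] by (simp add: S'_def s)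
    show "[s = i] (mod m)" using c beta by (simp add: s cong_mult_same_iff)
    fix t assume "t \<in> S'" "[t = i] (mod m)"
    then have "apery T' (\<beta> * m) (\<beta> * i) \<le> \<beta> * t"
      using beta by (intro T'.apery_le) (auto simp: S'_def cong_mult_same_iff)
    then show "s \<le> t" using beta by (simp add: s)
  qed
  then show ?thesis by (simp add: s)
qed

text \<open>Every class has the form \<open>\<beta> * i + j * \<alpha>\<close> with
  \<open>j < \<beta>\<close>, so its Apery element in \<open>T'\<close> lies in the gluing; the
  remaining multiple of \<open>\<beta> * m\<close> is absorbed by \<open>S'\<close>.\<close>

lemma T'_eq_gluing: "T' = gluing S' alpha' \<beta>"
proof
  show "gluing S' alpha' \<beta> \<subseteq> T'"
    using numerical_semigroup_mult[OF T'.semigroup alpha'_mem_T'] T'.add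
    by (auto simp: mem_gluing_iff S'_def)
  show "T' \<subseteq> gluing S' alpha' \<beta>"
  proof
    fix t assume t: "t \<in> T'"
    obtain i j where ij: "j < \<beta>" "[\<beta> * i + j * \<alpha> = t] (mod \<beta> * m)"
      using ex_residue_representation[OF alpha(2)] beta pos
      by (metis less_le_trans zero_less_numeral)
    obtain n where "t = apery T' (\<beta> * m) t + n * (\<beta> * m)"
      using T'.eq_apery_plus t by blast
    also have "apery T' (\<beta> * m) t = \<beta> * apery S' m i + j * alpha'"
      using apery_cong_arg[OF ij(2), of T'] apery_T'[OF ij(1), of i] by (simp add: apery_S')
    finally have "t = j * alpha' + \<beta> * (apery S' m i + n * m)"
      by (simp add: algebra_simps)
    moreover have "apery S' m i + n * m \<in> S'"
      by (intro S'.add S'.apery_mem numerical_semigroup_mult S'.semigroup S'.mem)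
    ultimately show "t \<in> gluing S' alpha' \<beta>" by (auto simp: mem_gluing_iff)
  qed
qed

lemma alpha'_mem_S': "alpha' \<in> S'"
  using numerical_semigroup_mult[OF T'.semigroup alpha'_mem_T'] by (simp add: S'_def)

text \<open>On classes divisible by \<beta>, the Apery elements of the gluing and of
  \<open>T'\<close> are \<beta> times those of \<open>S\<close> and \<open>S'\<close>.\<close>

lemma tight_S_iff:
  assumes "\<not> m dvd i + j"
  shows "apery S m i + apery S m j = apery S m (i + j) \<longleftrightarrow>
         apery S' m i + apery S' m j = apery S' m (i + j)"
proof -
  have b: "0 < \<beta>" using beta by simp
  have "\<not> \<beta> * m dvd \<beta> * i + \<beta> * j"
    using assms b by (simp flip: distrib_left)
  note tight_T_iff[OF this]
  moreover have T: "apery (gluing S \<alpha> \<beta>) (\<beta> * m) (\<beta> * i) = \<beta> * apery S m i" for i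
    using apery_T[of 0 i] b by simp
  ultimately have "\<beta> * apery S m i + \<beta> * apery S m j = \<beta> * apery S m (i + j) \<longleftrightarrow>
         \<beta> * apery S' m i + \<beta> * apery S' m j = \<beta> * apery S' m (i + j)"
    by (simp only: T apery_S' flip: distrib_left)
  then show ?thesis using b by (simp flip: distrib_left)
qed

lemma common_face: "\<exists>F'. lies_on_face S m F' \<and> lies_on_face S' m F'"
  by (rule ex_common_face[OF semigroup_with_modulus_axioms S'.semigroup_with_modulus_axioms
        tight_S_iff])

text \<open>Minimality of \<open>alpha'\<close> says that in \<open>T'\<close> the sum of the
  classes of \<open>(\<beta> - 1) * \<alpha>\<close> and \<alpha> is tight. Transferred to the
  gluing of \<open>S\<close>, this equality reads
  \<open>\<beta> * \<alpha> = \<beta> * apery S m \<alpha>\<close>.\<close>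

lemma alpha_minimal_if_alpha'_minimal:
  assumes m: "\<not> m dvd \<alpha>" and a': "alpha' = apery S' m \<alpha>"
  shows "\<alpha> = apery S m \<alpha>"
proof -
  \<comment> \<open>\<open>b\<close> is the largest multiplicity of \<alpha> that the formulas for
    Apery elements cover.\<close>
  obtain b where b: "\<beta> = Suc b" using beta by (cases \<beta>) auto
  have "apery T' (\<beta> * m) (b * \<alpha>) = b * alpha'"
    using apery_T'[of b 0] b T'.apery_0 by simp
  moreover have "apery T' (\<beta> * m) (b * \<alpha> + \<alpha>) = \<beta> * alpha'"
    using apery_S'[of \<alpha>] a' b by (simp add: add.commute)
  txt \<open>Since \<open>m\<close> does not divide \<open>\<alpha>\<close>, the chain of tight inequalities reaches \<open>\<beta>\<alpha>\<close>.\<close>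
  moreover have "\<not> \<beta> * m dvd b * \<alpha> + \<alpha>"
  proof -
    have "b * \<alpha> + \<alpha> = \<beta> * \<alpha>" by (simp add: b)
    then show ?thesis using m beta by simp
  qed
  note tight_T_iff[OF this]
  moreover have "b * alpha' + alpha' = \<beta> * alpha'" by (simp add: b)
  ultimately have "apery (gluing S \<alpha> \<beta>) (\<beta> * m) (b * \<alpha>) + \<alpha>
      = apery (gluing S \<alpha> \<beta>) (\<beta> * m) (b * \<alpha> + \<alpha>)"
    by (simp only: apery_T_alpha flip: alpha'_def)
  moreover have "apery (gluing S \<alpha> \<beta>) (\<beta> * m) (b * \<alpha>) = b * \<alpha>"
    using apery_T[of b 0] b by simp
  moreover have "apery (gluing S \<alpha> \<beta>) (\<beta> * m) (b * \<alpha> + \<alpha>) = \<beta> * apery S m \<alpha>"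
    using apery_T[of 0 \<alpha>] b by (simp add: add.commute)
  ultimately have "\<beta> * \<alpha> = \<beta> * apery S m \<alpha>" using b by simp
  then show ?thesis using beta by simp
qed

text \<open>A multiple of \<open>m\<close> other than \<open>m\<close> splits off one
  \<open>m\<close>; an element above the minimum of its class splits into that minimum and a
  multiple of \<open>m\<close>; for a minimal \<open>alpha'\<close> the decomposition of \<alpha> is
  carried over.\<close>

lemma alpha'_decompose:
  assumes "alpha' \<noteq> m" and p: "p \<in> S" "p \<noteq> 0" and q: "q \<in> S" "q \<noteq> 0" and pq: "\<alpha> = p + q"
  shows "\<exists>p'\<in>S'. \<exists>q'\<in>S'. p' \<noteq> 0 \<and> q' \<noteq> 0 \<and> alpha' = p' + q'"
proof (cases "m dvd alpha'")
  case True
  then obtain c where c: "alpha' = m * c" by blast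
  \<comment> \<open>Zero is coprime only to 1.\<close>
  have "alpha' \<noteq> 0" using coprime_alpha' beta by (intro notI) simp
  then obtain d where d: "c = Suc d" using c by (cases c) auto
  have "d \<noteq> 0" using d c assms(1) by auto
  then show ?thesis
    using c d pos S'.mem numerical_semigroup_mult[OF S'.semigroup S'.mem, of d]
    by (intro bexI[of _ m] bexI[of _ "d * m"]) (auto simp: mult.commute)
next
  case False
  have cong: "[alpha' = \<alpha>] (mod m)" using alpha'_cong by (rule cong_dvd_modulus_nat) simp
  then have m: "\<not> m dvd \<alpha>" using False by (simp add: cong_dvd_iff)
  have a: "apery S' m alpha' = apery S' m \<alpha>" by (rule apery_cong_arg[OF cong])
  obtain n where n: "alpha' = apery S' m \<alpha> + n * m"
    using S'.eq_apery_plus[of alpha'] alpha'_mem_S' a by metis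
  show ?thesis
  proof (cases "n = 0")
    case False
    have "apery S' m \<alpha> \<noteq> 0" using n \<open>\<not> m dvd alpha'\<close> by (intro notI) simp
    then show ?thesis
      using False n pos S'.apery_mem numerical_semigroup_mult[OF S'.semigroup S'.mem, of n]
      by (intro bexI[of _ "apery S' m \<alpha>"] bexI[of _ "n * m"]) auto
  next
    case True
    then have a': "alpha' = apery S' m \<alpha>" using n by simp
    then have "p + q = apery S m (p + q)"
      using alpha_minimal_if_alpha'_minimal[OF m] pq by simp
    moreover have "apery S m p \<le> p" "apery S m q \<le> q"
      using p q by (auto intro: apery_le)
    \<comment> \<open>A sum that is minimal in its class forces both summands to be minimal and the
      inequality between them to be tight.\<close>
    ultimately have ap: "apery S m p = p" "apery S m q = q"
      "apery S m p + apery S m q = apery S m (p + q)"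
      using apery_add_le[of p q] by linarith+
    have "apery S' m p + apery S' m q = alpha'"
      using tight_S_iff[of p q] m ap(3) a' pq by simp
    \<comment> \<open>A zero Apery element would put \<open>r\<close> in the zero class, whose
      minimum in \<open>S\<close> is 0.\<close>
    moreover have "apery S' m r \<noteq> 0" if "r \<noteq> 0" "apery S m r = r" for r
    proof
      assume "apery S' m r = 0"
      then have "[r = 0] (mod m)" using S'.apery_cong[of r] by (simp add: cong_sym)
      then show False using apery_cong_arg[of r 0 m S] that by simp
    qed
    ultimately show ?thesis
      using ap p q S'.apery_mem
      by (intro bexI[of _ "apery S' m p"] bexI[of _ "apery S' m q"]) auto
  qed
qed

end

theorem theorem6p11:
  fixes G T T' :: "nat set" and m \<alpha> \<beta> :: nat and F :: "(nat \<Rightarrow>\<^sub>0 real) set"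
  assumes "0 < m" and "m \<in> G"
    and "monoscopic_gluing G \<alpha> \<beta> T"
    and "lies_on_face T (\<beta> * m) F"
    and "lies_on_face T' (\<beta> * m) F"
  shows "\<exists>\<alpha>' S'.
           T' = gluing S' \<alpha>' \<beta> \<and> \<alpha>' \<in> S' \<and> coprime \<alpha>' \<beta> \<and>
           (\<alpha>' \<noteq> m \<longrightarrow> (\<exists>G'. S' = nat_span G' \<and> monoscopic_gluing G' \<alpha>' \<beta> T')) \<and>
           [\<alpha>' = \<alpha>] (mod \<beta> * m) \<and>
           (\<exists>F'. lies_on_face (nat_span G) m F' \<and> lies_on_face S' m F')"
proof -
  let ?S = "nat_span G"
  have glue: "finite G" "numerical_semigroup ?S" "2 \<le> \<beta>" "\<alpha> \<in> ?S" "\<alpha> \<notin> G" "coprime \<alpha> \<beta>"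
    "T = gluing ?S \<alpha> \<beta>"
    using assms(3) by (auto simp: monoscopic_gluing_def)
  interpret gluing_face ?S m \<alpha> \<beta> T' F
    using assms glue nat_span_base by unfold_locales auto
  have "\<alpha> \<noteq> 0" using glue by (intro notI) simp
  then obtain p q where pq: "p \<in> ?S" "q \<in> ?S" "p \<noteq> 0" "q \<noteq> 0" "\<alpha> = p + q"
    using nat_span_decompose glue by metis
  have "\<exists>G'. S' = nat_span G' \<and> monoscopic_gluing G' alpha' \<beta> T'" if m: "alpha' \<noteq> m"
  proof -
    obtain p' q' where "p' \<in> S'" "q' \<in> S'" "p' \<noteq> 0" "q' \<noteq> 0" "alpha' = p' + q'"
      using alpha'_decompose[OF m] pq by blast
    \<comment> \<open>Being a sum of two nonzero elements, \<open>alpha'\<close> can be left out of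
      a generating set of \<open>S'\<close>.\<close>
    then obtain G' where "finite G'" "S' = nat_span G'" "alpha' \<notin> G'"
      using S'.ex_generators_avoiding_sum by metis
    then show ?thesis
      using S'.semigroup glue alpha'_mem_S' coprime_alpha' T'_eq_gluing
      by (auto simp: monoscopic_gluing_def)
  qed
  then show ?thesis
    using T'_eq_gluing alpha'_mem_S' coprime_alpha' alpha'_cong common_face by blast
qed

end
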